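(* Let $p>2$ be a prime, let $K_p$ be the critical precision of $p$, let $k\ge K_p$, and let $A=A_k=\{a\in(\mathbb{Z}/p^k\mathbb{Z})^\times : a^p=a\}$. Then all nonzero sums $a+b$ with $a,b\in A$ are distinct in $\mathbb{Z}/p^k\mathbb{Z}$ apart from commutation; that is, if $a,b,c,d\in A$ and $a+b=c+d\neq 0$, then $\{a,b\}=\{c,d\}$. Hence $$|(A+A)\setminus\{0\}|=\tfrac12|A|^2=\frac{(p-1)^2}{2}.$$
   Context: The core $A_k$ is the subgroup of order $p-1$ of the unit group $G_k=(\mathbb{Z}/p^k\mathbb{Z})^\times$; equivalently $A_k=\{n^{p^{k-1}} \bmod p^k : p\nmid n\}$. Core function: $A_k(n)=n^{p^{k-1}}$ for integers $n$. Core increment: $d_k(n)=A_k(n+1)-A_k(n)$. Modulo $p^k$ both depend only on $n$ mod $p$, and $d_k(m)\equiv d_k(n) \pmod{p^k}$ whenever $m+n\equiv -1 \pmod p$. The critical precision $K_p$ is the smallest positive integer $k$ for which these symmetries $m+n\equiv-1 \pmod p$ are the only equivalences mod $p^k$ among the core increments, i.e. the smallest $k$ such that the residues $d_k(n)$ mod $p^k$ for $n=1,\dots,(p-1)/2$ are pairwise distinct. *)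

theory Defs
  imports "HOL-Number_Theory.Residues"
begin

abbreviation Zmod_pow :: "nat \<Rightarrow> nat \<Rightarrow> int ring" where
  "Zmod_pow p k \<equiv> residue_ring (int p ^ k)"

definition core :: "nat \<Rightarrow> nat \<Rightarrow> int set" where
  "core p k = {a \<in> Units (Zmod_pow p k). a [^]\<^bsub>Zmod_pow p k\<^esub> p = a}"

definition core_function :: "nat \<Rightarrow> nat \<Rightarrow> int \<Rightarrow> int" where
  "core_function p k n = n ^ (p ^ (k - 1))"

definition core_increment :: "nat \<Rightarrow> nat \<Rightarrow> int \<Rightarrow> int" where
  "core_increment p k n = core_function p k (n + 1) - core_function p k n"

text \<open>
  For every odd prime \<open>p\<close> some \<open>k\<close> satisfies the condition below, so the minimum exists:
  if two of the increments agreed modulo all powers of \<open>p\<close>, then two distinct unordered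
  pairs of \<open>(p - 1)\<close>-th roots of unity in the \<open>p\<close>-adic integers, hence also in the
  complex numbers, would have the same nonzero sum, which is impossible.
\<close>
definition critical_precision :: "nat \<Rightarrow> nat" where
  "critical_precision p =
     (LEAST k. k > 0 \<and>
        inj_on (\<lambda>n. core_increment p k n mod int p ^ k) {1..(int p - 1) div 2})"

end

theory Submission
  imports Defs
    "HOL-Number_Theory.Residue_Primitive_Roots"
    "HOL-Computational_Algebra.Fundamental_Theorem_Algebra"
    "HOL-Computational_Algebra.Polynomial_Factorial"
    "HOL-Computational_Algebra.Field_as_Ring"
begin

text \<open>
The nonzero sums are distinct because every failure of this is, after scaling, a coincidence
between core increments. An equation \<open>a + b = c + d\<close> in the core reads \<open>a - c = d - b\<close>. If \<open>a\<close> and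
\<open>c\<close> differ, they differ modulo \<open>p\<close>, and multiplication by the core element congruent to
\<open>1 / (a - c)\<close> turns the two differences into core increments. Beyond the critical precision
these agree only through the symmetry \<open>m + n \<equiv> - 1\<close>, and this leaves only \<open>a = d\<close> and \<open>a = - b\<close>
(\<open>core_function_sum_unique\<close>). The cardinality then follows by counting unordered pairs whose sum
is not zero (\<open>card_distinct_sums\<close>), since the core has \<open>p - 1\<close> elements, one for each nonzero
residue modulo \<open>p\<close>, and is closed under negation.

The argument presupposes that the critical precision is attained at all: a minimum over
the empty set would carry no information. So it has to be shown that two increments that are
not related by the symmetry differ modulo some power of \<open>p\<close>. Conceptually, a coincidence modulo
all powers of \<open>p\<close> would be an equation between sums of two \<open>(p - 1)\<close>-th roots of unity in
the \<open>p\<close>-adic integers, hence in the complex numbers, where such sums determine their summands unless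
they vanish (\<open>unit_circle_sum_unique\<close>). The proof below gives a finite form of this, without
\<open>p\<close>-adic numbers: a relation that no primitive complex \<open>N\<close>-th root of unity satisfies yields, by
Bezout's identity over the rationals and clearing denominators, a positive integer divisible by
every power of \<open>p\<close> modulo which the relation holds for an integer of order \<open>N = p - 1\<close> modulo \<open>p\<close>
(\<open>root_of_unity_relation_bound\<close>, \<open>core_increment_collision_bound\<close>). The coincidences of powers of
such an integer modulo \<open>p\<close> and of a primitive complex root of unity are the same, which translates the
relation into a congruence and back (\<open>no_complex_sum_relation\<close>).
\<close>

section \<open>Complex zeros of rational polynomials\<close>

definition complex_eval :: "rat poly \<Rightarrow> complex \<Rightarrow> complex" where
  "complex_eval F z = poly (map_poly of_rat F) z"

lemma complex_eval_0 [simp]: "complex_eval 0 z = 0"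
  and complex_eval_pCons [simp]: "complex_eval (pCons a F) z = of_rat a + z * complex_eval F z"
  by (simp_all add: complex_eval_def map_poly_pCons)

lemma complex_eval_add [simp]: "complex_eval (F + G) z = complex_eval F z + complex_eval G z"
  by (induction F G rule: poly_induct2) (simp_all add: of_rat_add algebra_simps)

lemma complex_eval_smult [simp]: "complex_eval (smult a F) z = of_rat a * complex_eval F z"
  by (induction F) (simp_all add: of_rat_mult algebra_simps)

lemma complex_eval_mult [simp]: "complex_eval (F * G) z = complex_eval F z * complex_eval G z"
  by (induction F) (simp_all add: algebra_simps)

lemma complex_eval_1 [simp]: "complex_eval 1 z = 1"
  by (simp add: one_pCons)

lemma complex_eval_monom [simp]: "complex_eval (monom c n) z = of_rat c * z ^ n"
  by (induction n) (simp_all add: monom_0 monom_Suc)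

lemma complex_eval_uminus [simp]: "complex_eval (- F) z = - complex_eval F z"
  by (metis add_eq_0_iff complex_eval_0 complex_eval_add)

lemma complex_eval_diff [simp]: "complex_eval (F - G) z = complex_eval F z - complex_eval G z"
  by (simp only: diff_conv_add_uminus complex_eval_add complex_eval_uminus)

lemma complex_eval_prod [simp]: "complex_eval (prod F I) z = (\<Prod>i\<in>I. complex_eval (F i) z)"
  by (induction I rule: infinite_finite_induct) simp_all

lemma complex_eval_dvd: "F dvd G \<Longrightarrow> complex_eval F z = 0 \<Longrightarrow> complex_eval G z = 0"
  by (auto elim!: dvdE)

lemma complex_eval_gcd:
  assumes "complex_eval F z = 0" "complex_eval G z = 0"
  shows "complex_eval (gcd F G) z = 0"
proof -
  have "gcd F G = fst (bezout_coefficients F G) * F + snd (bezout_coefficients F G) * G"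
    by (rule bezout_coefficients_fst_snd [symmetric])
  then show ?thesis
    using assms by (metis add.right_neutral complex_eval_add complex_eval_mult mult_zero_right)
qed

text \<open>
The fundamental theorem of algebra is what lets divisibility questions over the rationals be
settled by looking at complex zeros.
\<close>

lemma complex_eval_zero_exists:
  assumes "degree F \<noteq> 0"
  obtains z where "complex_eval F z = 0"
proof -
  have "degree (map_poly (of_rat :: rat \<Rightarrow> complex) F) = degree F"
    by (rule degree_map_poly) simp
  then have "\<not> constant (poly (map_poly (of_rat :: rat \<Rightarrow> complex) F))"
    using assms by (simp add: constant_degree)
  then show ?thesis
    using that fundamental_theorem_of_algebra unfolding complex_eval_def by blast
qed

text \<open>
A Nullstellensatz in one variable, with coefficients kept rational. Let \<open>D\<close> be the gcd of
\<open>F\<close> and \<open>X\<close>, so that \<open>D\<close> is a combination of the two, and let \<open>H\<close> be the cofactor of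
\<open>gcd D P\<close> in \<open>D\<close>. A complex zero of \<open>H\<close> is a common zero of \<open>F\<close> and \<open>X\<close>, hence a zero of
\<open>P\<close> and of \<open>gcd D P\<close>; it would then be a double zero of \<open>X\<close>. As the zeros of \<open>X\<close> are simple,
\<open>H\<close> is constant, that is, \<open>D\<close> divides \<open>P\<close>.
\<close>

lemma rational_nullstellensatz:
  assumes "X \<noteq> 0"
    and simple: "\<And>z. complex_eval X z = 0 \<Longrightarrow> complex_eval (pderiv X) z \<noteq> 0"
    and zeros: "\<And>z. complex_eval F z = 0 \<Longrightarrow> complex_eval X z = 0 \<Longrightarrow> complex_eval P z = 0"
  obtains U V where "P = U * F + V * X"
proof -
  define D where "D = gcd F X"
  have "D dvd F" "D dvd X" "D \<noteq> 0"
    using \<open>X \<noteq> 0\<close> by (auto simp: D_def)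
  obtain W where W: "X = D * W"
    using \<open>D dvd X\<close> by (elim dvdE)
  obtain H where H: "D = gcd D P * H"
    by (meson dvdE gcd_dvd1)
  have "degree H = 0"
  proof (rule ccontr)
    assume "degree H \<noteq> 0"
    then obtain z where z: "complex_eval H z = 0"
      by (rule complex_eval_zero_exists)
    have Dz: "complex_eval D z = 0"
      using H z by (metis complex_eval_mult mult_zero_right)
    then have "complex_eval P z = 0"
      using zeros complex_eval_dvd \<open>D dvd F\<close> \<open>D dvd X\<close> by blast
    then have Ez: "complex_eval (gcd D P) z = 0"
      using Dz by (intro complex_eval_gcd)
    have "X = gcd D P * (H * W)"
      using W H by (metis mult.assoc)
    then have "complex_eval (pderiv X) z = complex_eval (pderiv (gcd D P * (H * W))) z"
      by simp
    also have "\<dots> = 0"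
      unfolding pderiv_mult complex_eval_add complex_eval_mult using z Ez by simp
    finally show False
      using simple complex_eval_dvd [OF \<open>D dvd X\<close> Dz] by blast
  qed
  moreover have "H \<noteq> 0"
    using H \<open>D \<noteq> 0\<close> by auto
  ultimately have "is_unit H"
    by (simp add: is_unit_iff_degree)
  then have "D dvd gcd D P"
    using H by (metis dvd_refl mult_unit_dvd_iff)
  then obtain T where T: "P = D * T"
    by (meson dvd_trans gcd_dvd2 dvdE)
  obtain u v where D: "D = u * F + v * X"
    unfolding D_def by (metis bezout_coefficients_fst_snd)
  have "P = (T * u) * F + (T * v) * X"
    unfolding T D by (simp add: algebra_simps)
  then show ?thesis by (rule that)
qed

lemma common_denominator:
  fixes F :: "rat poly"
  obtains R :: int where "R > 0" and "\<And>w :: int. of_int R * poly F (of_int w) \<in> \<int>"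
proof -
  have "\<exists>R > 0. \<forall>w :: int. of_int R * poly F (of_int w) \<in> \<int>"
  proof (induction F)
    case 0
    show ?case by (intro exI [of _ 1]) simp
  next
    case (pCons a F)
    then obtain R :: int where R: "R > 0" "\<And>w :: int. of_int R * poly F (of_int w) \<in> \<int>"
      by blast
    obtain b c :: int where bc: "a = of_int b / of_int c" "c > 0"
      by (metis quotient_of_denom_pos quotient_of_div surj_pair)
    have "of_int (R * c) * poly (pCons a F) (of_int w) \<in> \<int>" for w :: int
    proof -
      have "of_int (R * c) * poly (pCons a F) (of_int w)
          = of_int (R * b) + of_int (c * w) * (of_int R * poly F (of_int w))"
        using bc by (simp add: field_simps)
      then show ?thesis
        using R(2) by (metis Ints_add Ints_mult Ints_of_int)
    qed
    then show ?case
      using R(1) bc(2) by (intro exI [of _ "R * c"]) simp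
  qed
  then show ?thesis using that by blast
qed

section \<open>Sums of two roots of unity\<close>

text \<open>
This replaces the passage from the \<open>p\<close>-adic to the complex numbers. The polynomial
\<open>F = x ^ a + x ^ b - x ^ c - x ^ d\<close> may vanish at some \<open>N\<close>-th roots of unity, but by hypothesis
only at those of order less than \<open>N\<close>, which are zeros of the product \<open>P\<close> of all \<open>x ^ i - 1\<close> with
\<open>0 < i < N\<close>. So \<open>P = U * F + V * (x ^ N - 1)\<close> with rational \<open>U\<close> and \<open>V\<close>, and \<open>R\<close> clears their
denominators. Since \<open>R\<close> depends on neither \<open>M\<close> nor \<open>w\<close>, it bounds the powers \<open>M\<close> of
a prime modulo which the relation can hold for an integer \<open>w\<close> that has order \<open>N\<close> modulo that prime.
\<close>

lemma root_of_unity_relation_bound: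
  assumes "N > 0"
    and no_relation: "\<And>z :: complex. z ^ N = 1 \<Longrightarrow> (\<And>i. 0 < i \<Longrightarrow> i < N \<Longrightarrow> z ^ i \<noteq> 1) \<Longrightarrow>
      z ^ a + z ^ b \<noteq> z ^ c + z ^ d"
  obtains R :: int where "R > 0"
    and "\<And>M w :: int. [w ^ N = 1] (mod M) \<Longrightarrow> [w ^ a + w ^ b = w ^ c + w ^ d] (mod M) \<Longrightarrow>
      M dvd R * (\<Prod>i\<in>{0<..<N}. w ^ i - 1)"
proof -
  define X :: "rat poly" where "X = monom 1 N - 1"
  define F :: "rat poly" where "F = monom 1 a + monom 1 b - monom 1 c - monom 1 d"
  define P :: "rat poly" where "P = (\<Prod>i\<in>{0<..<N}. monom 1 i - 1)"
  have "coeff X N = 1"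
    using \<open>N > 0\<close> by (simp add: X_def)
  then have "X \<noteq> 0" by auto
  moreover have "complex_eval (pderiv X) z \<noteq> 0" if "complex_eval X z = 0" for z
  proof -
    have "z ^ N = 1" using that by (simp add: X_def)
    then have "z \<noteq> 0" using \<open>N > 0\<close> by (auto simp: power_0_left)
    then show ?thesis
      using \<open>N > 0\<close> by (simp add: X_def pderiv_diff pderiv_monom)
  qed
  moreover have "complex_eval P z = 0" if "complex_eval F z = 0" "complex_eval X z = 0" for z
  proof -
    have "z ^ N = 1" "z ^ a + z ^ b = z ^ c + z ^ d"
      using that by (simp_all add: X_def F_def algebra_simps)
    then obtain i where "0 < i" "i < N" "z ^ i = 1"
      using no_relation by blast
    then show ?thesis
      by (auto simp: P_def intro!: prod_zero)
  qed
  ultimately obtain U V where UV: "P = U * F + V * X"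
    by (rule rational_nullstellensatz)
  obtain R where R: "R > 0" "\<And>w :: int. of_int R * poly U (of_int w) \<in> \<int>"
    by (rule common_denominator [of U]) blast
  obtain S where S: "S > 0" "\<And>w :: int. of_int S * poly V (of_int w) \<in> \<int>"
    by (rule common_denominator [of V]) blast
  show ?thesis
  proof (rule that [of "R * S"])
    show "R * S > 0"
      using R(1) S(1) by simp
  next
    fix M w :: int
    assume wX: "[w ^ N = 1] (mod M)" and wF: "[w ^ a + w ^ b = w ^ c + w ^ d] (mod M)"
    obtain u where u: "of_int R * poly U (of_int w) = of_int u"
      using R(2) by (meson Ints_cases)
    obtain v where v: "of_int S * poly V (of_int w) = of_int v"
      using S(2) by (meson Ints_cases)
    have "of_int ((R * S) * (\<Prod>i\<in>{0<..<N}. w ^ i - 1)) = of_int (R * S) * poly P (of_int w)"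
      by (simp add: P_def poly_prod poly_monom)
    also have "\<dots> = of_int S * (of_int R * poly U (of_int w)) * poly F (of_int w)
        + of_int R * (of_int S * poly V (of_int w)) * poly X (of_int w)"
      unfolding UV by (simp add: algebra_simps)
    also have "\<dots> = of_int (S * u * (w ^ a + w ^ b - w ^ c - w ^ d) + R * v * (w ^ N - 1))"
      unfolding u v by (simp add: F_def X_def poly_monom)
    finally have "(R * S) * (\<Prod>i\<in>{0<..<N}. w ^ i - 1)
        = S * u * (w ^ a + w ^ b - w ^ c - w ^ d) + R * v * (w ^ N - 1)"
      by (simp only: of_int_eq_iff)
    moreover have "M dvd w ^ a + w ^ b - w ^ c - w ^ d" "M dvd w ^ N - 1"
      using wX wF by (simp_all add: cong_iff_dvd_diff algebra_simps)
    ultimately show "M dvd (R * S) * (\<Prod>i\<in>{0<..<N}. w ^ i - 1)"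
      by simp
  qed
qed

text \<open>
On the unit circle conjugation is inversion, so conjugating \<open>a + b = c + d\<close> and clearing
denominators gives \<open>(a + b) * (c * d) = (c + d) * (a * b)\<close>. When the common sum is nonzero, the two
pairs have the same product as well, and are the zeros of the same quadratic.
\<close>

lemma unit_circle_sum_unique:
  fixes a b c d :: complex
  assumes norm: "cmod a = 1" "cmod b = 1" "cmod c = 1" "cmod d = 1"
    and sum: "a + b = c + d" "a + b \<noteq> 0"
  shows "a = c \<or> b = c"
proof -
  have inv: "z * cnj z = 1" if "cmod z = 1" for z
    using that complex_norm_square [of z] by simp
  have "(a + b) * (c * d) = (b * cnj b) * a * (c * d) + (a * cnj a) * b * (c * d)"
    by (simp only: inv norm mult_1_left distrib_right)
  also have "\<dots> = (cnj a + cnj b) * (a * b * c * d)"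
    by (simp only: algebra_simps)
  also have "\<dots> = (cnj c + cnj d) * (a * b * c * d)"
    using arg_cong [OF sum(1), of cnj] by simp
  also have "\<dots> = (c * cnj c) * (a * b * d) + (d * cnj d) * (a * b * c)"
    by (simp only: algebra_simps)
  also have "\<dots> = (c + d) * (a * b)"
    by (simp only: inv norm mult_1_left) (simp add: algebra_simps)
  also have "\<dots> = (a + b) * (a * b)"
    by (simp only: sum)
  finally have prod: "c * d = a * b"
    using sum(2) mult_left_cancel by blast
  have "(c - a) * (c - b) = c * c - (a + b) * c + a * b"
    by (simp add: algebra_simps)
  also have "\<dots> = c * c - (c + d) * c + c * d"
    by (simp only: sum prod)
  also have "\<dots> = 0"
    by (simp add: algebra_simps)
  finally show ?thesis by auto
qed

text \<open>
Complex numbers of multiplicative order \<open>N\<close> have the same coincidences among their powers as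
a primitive root modulo \<open>p\<close> has when \<open>N = p - 1\<close>; this is how congruences are moved to the complex
numbers and back.
\<close>

lemma complex_primitive_root_power_eq_iff:
  fixes z :: complex
  assumes "z ^ N = 1" "N > 0" and primitive: "\<And>d. 0 < d \<Longrightarrow> d < N \<Longrightarrow> z ^ d \<noteq> 1"
  shows "z ^ i = z ^ j \<longleftrightarrow> [i = j] (mod N)"
proof -
  have red: "z ^ i = z ^ (i mod N)" for i
    using assms(1) by (metis div_mult_mod_eq mult.commute mult_1 power_add power_mult power_one)
  have "z \<noteq> 0"
    using assms by (auto simp: power_0_left)
  have less: "i = j" if "z ^ i = z ^ j" "i \<le> j" "j < N" for i j
  proof -
    have "z ^ (j - i) = 1"
      using that \<open>z \<noteq> 0\<close> by (simp add: power_diff)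
    then show ?thesis
      using primitive [of "j - i"] that by force
  qed
  have "z ^ (i mod N) = z ^ (j mod N) \<longleftrightarrow> i mod N = j mod N"
    using less [of "i mod N" "j mod N"] less [of "j mod N" "i mod N"] \<open>N > 0\<close>
    by (metis mod_less_divisor nle_le)
  then show ?thesis
    unfolding cong_def by (subst (1 2) red)
qed

section \<open>The core function\<close>

text \<open>
Raising to the power \<open>p\<close> gains one factor \<open>p\<close>: in
\<open>X ^ p - Y ^ p = (X - Y) * (\<Sum>j<p. Y ^ (p - Suc j) * X ^ j)\<close>
all \<open>p\<close> summands are congruent modulo \<open>p\<close> if \<open>X\<close> and \<open>Y\<close> are, so the sum is divisible by \<open>p\<close>.
\<close>

lemma cong_power_lift:
  fixes x y :: int
  assumes "[x = y] (mod int p)"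
  shows "[x ^ p ^ i = y ^ p ^ i] (mod int p ^ Suc i)"
proof (induction i)
  case 0
  show ?case using assms by simp
next
  case (Suc i)
  define X Y where "X = x ^ p ^ i" and "Y = y ^ p ^ i"
  have "[X = Y] (mod int p ^ Suc i)"
    using Suc by (simp add: X_def Y_def)
  then have XY: "int p ^ Suc i dvd X - Y"
    by (simp add: cong_iff_dvd_diff)
  have "[X = Y] (mod int p)"
    unfolding X_def Y_def by (intro cong_pow assms)
  then have "[(\<Sum>j<p. Y ^ (p - Suc j) * X ^ j) = (\<Sum>j<p. Y ^ (p - Suc j) * Y ^ j)] (mod int p)"
    by (intro cong_sum cong_mult cong_refl cong_pow)
  also have "(\<Sum>j<p. Y ^ (p - Suc j) * Y ^ j) = (\<Sum>j<p. Y ^ (p - 1))"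
    by (intro sum.cong) (simp_all flip: power_add)
  also have "[\<dots> = 0] (mod int p)"
    by (simp add: cong_0_iff)
  finally have "int p dvd (\<Sum>j<p. Y ^ (p - Suc j) * X ^ j)"
    by (simp add: cong_0_iff)
  with XY have "int p ^ Suc i * int p dvd (X - Y) * (\<Sum>j<p. Y ^ (p - Suc j) * X ^ j)"
    by (rule mult_dvd_mono)
  then have "[X ^ p = Y ^ p] (mod int p ^ Suc (Suc i))"
    by (simp add: cong_iff_dvd_diff power_diff_sumr2 mult.commute)
  then show ?case
    by (simp add: X_def Y_def mult.commute flip: power_mult)
qed

lemma core_function_cong:
  assumes "[x = y] (mod int p)" "k > 0"
  shows "[core_function p k x = core_function p k y] (mod int p ^ k)"
  using cong_power_lift [OF assms(1), of "k - 1"] assms(2)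
  by (simp add: core_function_def)

lemma core_function_mult: "core_function p k (x * y) = core_function p k x * core_function p k y"
  by (simp add: core_function_def power_mult_distrib)

lemma core_function_uminus: "odd p \<Longrightarrow> core_function p k (- x) = - core_function p k x"
  by (simp add: core_function_def)

lemma cong_power_iterate:
  fixes x :: int
  assumes "[x ^ p = x] (mod m)"
  shows "[x ^ p ^ i = x] (mod m)"
proof (induction i)
  case (Suc i)
  have "[(x ^ p ^ i) ^ p = x ^ p] (mod m)"
    by (intro cong_pow Suc)
  then show ?case
    using assms by (metis cong_trans power_Suc2 power_mult)
qed simp

lemma fermat_little_int:
  fixes x :: int
  assumes "prime p"
  shows "[x ^ p = x] (mod int p)"
proof (cases "int p dvd x")
  case True
  then show ?thesis
    unfolding cong_iff_dvd_diff using prime_gt_0_nat [OF assms]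
    by (intro dvd_diff) (auto intro: dvd_trans [OF _ dvd_power])
next
  case False
  interpret residues_prime p "residue_ring (int p)"
    by unfold_locales (use assms in simp_all)
  have "[x ^ (p - 1) = 1] (mod int p)"
    using False euler_theorem [of x] by (simp add: p_coprime_right_int totient_prime assms)
  then have "[x ^ (p - 1) * x = 1 * x] (mod int p)"
    by (intro cong_mult cong_refl)
  then show ?thesis
    using prime_gt_0_nat [OF assms] by (simp only: power_minus_mult mult_1_left)
qed

text \<open>
Together with \<open>core_function_cong\<close> this says that the core function is a system of
Teichmueller representatives modulo \<open>p ^ k\<close>: a multiplicative choice of one lift for each
residue modulo \<open>p\<close>.
\<close>

lemma core_function_cong_self:
  assumes "prime p"
  shows "[core_function p k x = x] (mod int p)"
  unfolding core_function_def by (intro cong_power_iterate fermat_little_int assms)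

section \<open>Existence of the critical precision\<close>

text \<open>
A generator of the unit group modulo \<open>p\<close>, presented so that all work with units becomes work
with exponents modulo \<open>p - 1\<close>.
\<close>

lemma prime_primitive_root:
  assumes "prime p"
  obtains g :: int where "\<And>x. \<not> int p dvd x \<Longrightarrow> \<exists>i. [x = g ^ i] (mod int p)"
    and "\<And>i j. [g ^ i = g ^ j] (mod int p) \<longleftrightarrow> [i = j] (mod p - 1)"
proof -
  have "p > 1" using assms by (rule prime_gt_1_nat)
  obtain g where g: "residue_primroot p g"
    using prime_primitive_root_exists assms \<open>p > 1\<close> by blast
  have gen: "(\<lambda>i. g ^ i mod p) ` {..<totient p} = totatives p"
    using residue_primroot_is_generator [OF \<open>p > 1\<close> g] by (simp add: bij_betw_def)
  show ?thesis
  proof (rule that [of "int g"])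
    fix x assume "\<not> int p dvd x"
    define y where "y = nat (x mod int p)"
    have y: "int y = x mod int p"
      using \<open>p > 1\<close> by (simp add: y_def)
    have "y \<noteq> 0"
      using y \<open>\<not> int p dvd x\<close> by (metis dvd_eq_mod_eq_0 of_nat_0)
    moreover have "y < p"
      using y \<open>p > 1\<close> by (metis of_nat_0_less_iff of_nat_less_iff order_less_trans pos_mod_bound zero_less_one)
    ultimately have "y \<in> totatives p"
      using assms by (simp add: totatives_prime)
    then obtain i where "y = g ^ i mod p"
      using gen by blast
    then have "[y = g ^ i] (mod p)"
      by (simp add: cong_def)
    then have "[int y = int g ^ i] (mod int p)"
      by (metis cong_int_iff of_nat_power)
    then have "[x = int g ^ i] (mod int p)"
      by (simp add: y cong_def)
    then show "\<exists>i. [x = int g ^ i] (mod int p)" ..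
  next
    fix i j
    have "[g ^ i = g ^ j] (mod p) \<longleftrightarrow> [i = j] (mod p - 1)"
      using g order_divides_expdiff [of p g i j] assms
      by (simp add: residue_primroot_def totient_prime)
    then show "[int g ^ i = int g ^ j] (mod int p) \<longleftrightarrow> [i = j] (mod p - 1)"
      by (metis cong_int_iff of_nat_power)
  qed
qed

text \<open>
The exponents \<open>a\<close>, \<open>b\<close>, \<open>c\<close>, \<open>d\<close> are the discrete logarithms of \<open>n\<close>, \<open>n + 1\<close>, \<open>m\<close>, \<open>m + 1\<close>.
If the relation held, the two pairs of complex roots of unity would either coincide, which implies
\<open>n + 1 \<equiv> m + 1\<close> or \<open>m \<equiv> m + 1\<close> modulo \<open>p\<close>, or both have sum zero, which implies
\<open>m \<equiv> - (n + 1)\<close>. The hypotheses on \<open>n\<close> and \<open>m\<close> rule all of this out.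
\<close>

lemma no_complex_sum_relation:
  fixes z :: complex and n m :: int and a b c d :: nat
  assumes "prime p"
    and range: "0 < n" "0 < m" "n \<noteq> m" "n + m + 1 < int p"
    and root: "\<And>i j. [g ^ i = g ^ j] (mod int p) \<longleftrightarrow> [i = j] (mod p - 1)"
    and exps: "[n = g ^ a] (mod int p)" "[n + 1 = g ^ b] (mod int p)"
      "[m = g ^ c] (mod int p)" "[m + 1 = g ^ d] (mod int p)"
    and z: "z ^ (p - 1) = 1" "\<And>i. 0 < i \<Longrightarrow> i < p - 1 \<Longrightarrow> z ^ i \<noteq> 1"
  shows "z ^ b + z ^ c \<noteq> z ^ d + z ^ a"
proof
  assume eq: "z ^ b + z ^ c = z ^ d + z ^ a"
  have "p - 1 > 0"
    using prime_gt_1_nat [OF \<open>prime p\<close>] by simp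
  have transfer: "z ^ i = z ^ j \<longleftrightarrow> [g ^ i = g ^ j] (mod int p)" for i j
    unfolding root by (intro complex_primitive_root_power_eq_iff z \<open>p - 1 > 0\<close>)
  have small: "x = y" if "[x = y] (mod int p)" "\<bar>x - y\<bar> < int p" for x y :: int
    using that zdvd_not_zless [of "\<bar>x - y\<bar>" "int p"] by (force simp: cong_iff_dvd_diff)
  have "cmod z ^ (p - 1) = 1"
    using z(1) by (metis norm_one norm_power)
  then have "cmod z = 1"
    using \<open>p - 1 > 0\<close> power_eq_imp_eq_base [of "cmod z" "p - 1" 1] by simp
  then have norm: "cmod (z ^ i) = 1" for i
    by (simp add: norm_power)
  have "z ^ b + z ^ c \<noteq> 0"
  proof
    assume "z ^ b + z ^ c = 0"
    then have neg: "z ^ c = - (z ^ b)"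
      by (simp add: add_eq_0_iff)
    \<comment> \<open>Squaring removes the sign, so that only powers of \<open>z\<close> occur and can be translated.\<close>
    then have "z ^ (2 * c) = z ^ (2 * b)"
      by (simp add: power_mult power2_eq_square mult.commute [of 2])
    then have "[(g ^ c)\<^sup>2 = (g ^ b)\<^sup>2] (mod int p)"
      unfolding transfer by (simp add: mult.commute flip: power_mult)
    moreover have "[m\<^sup>2 = (g ^ c)\<^sup>2] (mod int p)" "[(n + 1)\<^sup>2 = (g ^ b)\<^sup>2] (mod int p)"
      using exps by (intro cong_pow; simp)+
    ultimately have "[m\<^sup>2 = (n + 1)\<^sup>2] (mod int p)"
      by (metis cong_sym cong_trans)
    then have "int p dvd (m - (n + 1)) * (m + (n + 1))"
      by (simp add: cong_iff_dvd_diff power2_eq_square algebra_simps)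
    then consider "int p dvd m - (n + 1)" | "int p dvd m + (n + 1)"
      using \<open>prime p\<close> by (metis prime_dvd_multD prime_nat_int_transfer)
    then show False
    proof cases
      case 1
      then have "[m = n + 1] (mod int p)"
        by (simp add: cong_iff_dvd_diff)
      then have "z ^ c = z ^ b"
        unfolding transfer using exps by (metis cong_sym cong_trans)
      then have "z ^ b = 0"
        using neg by simp
      then show False
        using norm [of b] by (metis norm_zero zero_neq_one)
    next
      case 2
      then show False
        using range zdvd_not_zless [of "m + (n + 1)" "int p"] by simp
    qed
  qed
  then consider "z ^ b = z ^ d" | "z ^ c = z ^ d"
    using unit_circle_sum_unique [of "z ^ b" "z ^ c" "z ^ d" "z ^ a"] norm eq by blast
  then show False
  proof cases
    case 1
    then have "[n + 1 = m + 1] (mod int p)"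
      unfolding transfer using exps by (metis cong_sym cong_trans)
    moreover have "\<bar>(n + 1) - (m + 1)\<bar> < int p"
      using range by linarith
    ultimately have "n + 1 = m + 1"
      by (rule small)
    then show False
      using range by simp
  next
    case 2
    then have "[m = m + 1] (mod int p)"
      unfolding transfer using exps by (metis cong_sym cong_trans)
    then show False
      using small [of m "m + 1"] prime_gt_1_nat [OF \<open>prime p\<close>] by simp
  qed
qed

text \<open>
With \<open>w = core_function p k g\<close> for a primitive root \<open>g\<close>, the equality of the two increments is the
relation \<open>w ^ b + w ^ c \<equiv> w ^ d + w ^ a\<close> modulo \<open>p ^ k\<close>. The bound of
\<open>root_of_unity_relation_bound\<close> applies because \<open>w \<equiv> g\<close> still has order \<open>p - 1\<close> modulo \<open>p\<close>, so
that the product of the \<open>w ^ i - 1\<close> is prime to \<open>p\<close>. The exponents do not depend on \<open>k\<close>,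
hence neither does \<open>R\<close>.
\<close>

lemma core_increment_collision_bound:
  assumes "prime p" and range: "0 < n" "0 < m" "n \<noteq> m" "n + m + 1 < int p"
  obtains R :: int where
    "\<And>k. k > 0 \<Longrightarrow> [core_increment p k n = core_increment p k m] (mod int p ^ k) \<Longrightarrow> int p ^ k \<le> R"
proof -
  have "p > 1"
    using assms(1) by (rule prime_gt_1_nat)
  obtain g where gen: "\<And>x. \<not> int p dvd x \<Longrightarrow> \<exists>i. [x = g ^ i] (mod int p)"
    and root: "\<And>i j. [g ^ i = g ^ j] (mod int p) \<longleftrightarrow> [i = j] (mod p - 1)"
    using prime_primitive_root [OF assms(1)] by blast
  have "\<exists>i. [x = g ^ i] (mod int p)" if "0 < x" "x < int p" for x
    using that by (intro gen) (rule zdvd_not_zless)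
  from this [of n] this [of "n + 1"] this [of m] this [of "m + 1"]
  obtain a b c d where exps: "[n = g ^ a] (mod int p)" "[n + 1 = g ^ b] (mod int p)"
      "[m = g ^ c] (mod int p)" "[m + 1 = g ^ d] (mod int p)"
    using range by auto
  have "p - 1 > 0" using \<open>p > 1\<close> by simp
  obtain R :: int where R: "R > 0" "\<And>M w :: int. [w ^ (p - 1) = 1] (mod M) \<Longrightarrow>
      [w ^ b + w ^ c = w ^ d + w ^ a] (mod M) \<Longrightarrow> M dvd R * (\<Prod>i\<in>{0<..<p - 1}. w ^ i - 1)"
    using root_of_unity_relation_bound [OF \<open>p - 1 > 0\<close>
        no_complex_sum_relation [OF assms(1) range root exps]] by metis
  show ?thesis
  proof (rule that)
    fix k :: nat
    assume "k > 0" and coll: "[core_increment p k n = core_increment p k m] (mod int p ^ k)"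
    define w where "w = core_function p k g"
    have wpow: "w ^ i = core_function p k (g ^ i)" for i
      by (simp add: w_def core_function_def mult.commute flip: power_mult)
    have w: "[core_function p k x = w ^ i] (mod int p ^ k)" if "[x = g ^ i] (mod int p)" for x i
      unfolding wpow using that \<open>k > 0\<close> by (rule core_function_cong)
    have "[g ^ (p - 1) = g ^ 0] (mod int p)"
      unfolding root by (simp add: cong_def)
    then have "[w ^ (p - 1) = w ^ 0] (mod int p ^ k)"
      using w wpow by metis
    moreover have "[w ^ b + w ^ c = w ^ d + w ^ a] (mod int p ^ k)"
    proof -
      have "[core_function p k (n + 1) + core_function p k m
          = core_function p k (m + 1) + core_function p k n] (mod int p ^ k)"
        using coll by (simp add: core_increment_def cong_iff_dvd_diff algebra_simps)
      moreover have "[core_function p k (n + 1) + core_function p k m = w ^ b + w ^ c] (mod int p ^ k)"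
        "[core_function p k (m + 1) + core_function p k n = w ^ d + w ^ a] (mod int p ^ k)"
        using exps by (auto intro!: cong_add w)
      ultimately show ?thesis
        by (metis cong_sym cong_trans)
    qed
    ultimately have dvd: "int p ^ k dvd R * (\<Prod>i\<in>{0<..<p - 1}. w ^ i - 1)"
      using R(2) by simp
    have "\<not> int p dvd w ^ i - 1" if "i \<in> {0<..<p - 1}" for i
    proof
      assume "int p dvd w ^ i - 1"
      then have "[w ^ i = 1] (mod int p)"
        by (simp add: cong_iff_dvd_diff)
      moreover have "[w ^ i = g ^ i] (mod int p)"
        unfolding w_def by (intro cong_pow core_function_cong_self assms)
      ultimately have "[g ^ i = g ^ 0] (mod int p)"
        by (metis cong_sym cong_trans power_0)
      then show False
        unfolding root using that by (simp add: cong_def)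
    qed
    then have "\<not> int p dvd (\<Prod>i\<in>{0<..<p - 1}. w ^ i - 1)"
      using assms(1) by (subst prime_dvd_prod_iff) auto
    then have "coprime (int p ^ k) (\<Prod>i\<in>{0<..<p - 1}. w ^ i - 1)"
      using assms(1) by (simp add: prime_imp_coprime)
    then have "int p ^ k dvd R"
      using dvd by (simp add: coprime_dvd_mult_left_iff)
    then show "int p ^ k \<le> R"
      using R(1) by (rule zdvd_imp_le)
  qed
qed

text \<open>
There are finitely many pairs of distinct \<open>n\<close> and \<open>m\<close>, so every \<open>k\<close> with \<open>p ^ k\<close> above all
their bounds separates them.
\<close>

lemma separating_precision_exists:
  assumes "prime p"
  shows "\<exists>k > 0. inj_on (\<lambda>n. core_increment p k n mod int p ^ k) {1..(int p - 1) div 2}"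
proof -
  let ?I = "{1..(int p - 1) div 2}"
  have "\<exists>R. \<forall>k > 0. [core_increment p k n = core_increment p k m] (mod int p ^ k) \<longrightarrow> int p ^ k \<le> R"
    if "(n, m) \<in> ?I \<times> ?I - Id" for n m
  proof -
    have range: "0 < n" "0 < m" "n \<noteq> m" "n + m + 1 < int p"
      using that by auto
    show ?thesis
      by (rule core_increment_collision_bound [OF assms range]) blast
  qed
  then obtain R where R: "\<And>n m k. (n, m) \<in> ?I \<times> ?I - Id \<Longrightarrow> k > 0 \<Longrightarrow>
      [core_increment p k n = core_increment p k m] (mod int p ^ k) \<Longrightarrow> int p ^ k \<le> R n m"
    by metis
  define B where "B = Max (insert 1 ((\<lambda>(n, m). R n m) ` (?I \<times> ?I - Id)))"
  have B: "R n m \<le> B" if "(n, m) \<in> ?I \<times> ?I - Id" for n m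
    unfolding B_def using that by (intro Max_ge) auto
  have "B \<ge> 1"
    unfolding B_def by (intro Max_ge) auto
  define k where "k = nat B"
  have "k > 0"
    using \<open>B \<ge> 1\<close> by (simp add: k_def)
  \<comment> \<open>\<open>k = B\<close> is large enough because \<open>B < p ^ B\<close>.\<close>
  have "k < p ^ k"
    using prime_gt_1_nat [OF assms] by (intro power_gt_expt) simp
  then have "B < int p ^ k"
    using \<open>B \<ge> 1\<close> by (simp add: k_def flip: of_nat_power)
  have "inj_on (\<lambda>n. core_increment p k n mod int p ^ k) ?I"
  proof (rule inj_onI, rule ccontr)
    fix n m
    assume "n \<in> ?I" "m \<in> ?I" "n \<noteq> m"
      and "core_increment p k n mod int p ^ k = core_increment p k m mod int p ^ k"
    then show False
      using R [of n m k] B [of n m] \<open>k > 0\<close> \<open>B < int p ^ k\<close> by (auto simp: cong_def)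
  qed
  then show ?thesis
    using \<open>k > 0\<close> by blast
qed

text \<open>
Increments of higher precision refine those of lower precision:
\<open>core_function p k x = core_function p j (x ^ p ^ (k - j))\<close>, and \<open>x ^ p ^ (k - j) \<equiv> x\<close> modulo \<open>p\<close>.
Consequently increments that are distinct at precision \<open>j\<close> stay distinct at every larger one.
\<close>

lemma core_increment_cong_precision:
  assumes "prime p" "0 < j" "j \<le> k"
  shows "[core_increment p k n = core_increment p j n] (mod int p ^ j)"
proof -
  have "[core_function p k x = core_function p j x] (mod int p ^ j)" for x
  proof -
    have "p ^ (k - 1) = p ^ (k - j) * p ^ (j - 1)"
      using assms by (simp flip: power_add)
    then have "core_function p k x = core_function p j (x ^ p ^ (k - j))"
      by (simp add: core_function_def power_mult)
    moreover have "[x ^ p ^ (k - j) = x] (mod int p)"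
      by (intro cong_power_iterate fermat_little_int assms)
    ultimately show ?thesis
      using core_function_cong \<open>0 < j\<close> by metis
  qed
  then show ?thesis
    unfolding core_increment_def by (intro cong_diff)
qed

lemma separating_from_critical_precision:
  assumes "prime p" "k \<ge> critical_precision p"
  shows "k > 0" "inj_on (\<lambda>n. core_increment p k n mod int p ^ k) {1..(int p - 1) div 2}"
proof -
  let ?K = "critical_precision p"
  have K: "?K > 0" "inj_on (\<lambda>n. core_increment p ?K n mod int p ^ ?K) {1..(int p - 1) div 2}"
    using LeastI_ex [OF separating_precision_exists [OF assms(1)]]
    unfolding critical_precision_def by blast+
  then show "k > 0"
    using assms(2) by simp
  show "inj_on (\<lambda>n. core_increment p k n mod int p ^ k) {1..(int p - 1) div 2}"
  proof (rule inj_onI)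
    fix n m
    assume nm: "n \<in> {1..(int p - 1) div 2}" "m \<in> {1..(int p - 1) div 2}"
      and "core_increment p k n mod int p ^ k = core_increment p k m mod int p ^ k"
    then have "[core_increment p k n = core_increment p k m] (mod int p ^ k)"
      by (simp add: cong_def)
    then have "[core_increment p k n = core_increment p k m] (mod int p ^ ?K)"
      using assms(2) by (rule cong_dvd_modulus [OF _ le_imp_power_dvd])
    then have "[core_increment p ?K n = core_increment p ?K m] (mod int p ^ ?K)"
      using core_increment_cong_precision [OF assms(1) K(1) assms(2)]
      by (metis cong_sym cong_trans)
    then show "n = m"
      using K(2) nm by (auto simp: cong_def dest: inj_onD)
  qed
qed

section \<open>Coincidences of increments and of sums\<close>

text \<open>
The symmetry \<open>n \<mapsto> - 1 - n\<close> sends \<open>n + 1\<close> to \<open>- n\<close> and \<open>n\<close> to \<open>- (n + 1)\<close>, and the core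
function is odd.
\<close>

lemma core_increment_reflect:
  assumes "odd p" "k > 0" "[m = - 1 - n] (mod int p)"
  shows "[core_increment p k m = core_increment p k n] (mod int p ^ k)"
proof -
  have "[core_function p k (m + 1) = core_function p k (- n)] (mod int p ^ k)"
    using assms cong_add [OF assms(3) cong_refl, of 1] by (intro core_function_cong) simp_all
  moreover have "[core_function p k m = core_function p k (- (n + 1))] (mod int p ^ k)"
    using assms by (intro core_function_cong) (simp_all add: algebra_simps)
  ultimately have "[core_increment p k m = core_function p k (- n) - core_function p k (- (n + 1))] (mod int p ^ k)"
    unfolding core_increment_def by (rule cong_diff)
  then show ?thesis
    unfolding core_function_uminus [OF assms(1)] by (simp add: core_increment_def)
qed

lemma core_increment_cong:
  assumes "[m = n] (mod int p)" "k > 0"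
  shows "[core_increment p k m = core_increment p k n] (mod int p ^ k)"
  unfolding core_increment_def using assms by (intro cong_diff core_function_cong cong_add cong_refl)

text \<open>
Up to reflection, every residue other than \<open>0\<close> and \<open>- 1\<close> is represented in the range over
which the critical precision is defined.
\<close>

lemma core_increment_representative:
  assumes "odd p" "k > 0" "\<not> int p dvd n" "\<not> int p dvd n + 1"
  obtains r where "r \<in> {1..(int p - 1) div 2}" "[r = n] (mod int p) \<or> [r = - 1 - n] (mod int p)"
    "[core_increment p k r = core_increment p k n] (mod int p ^ k)"
proof -
  define s where "s = n mod int p"
  have "p > 0" using \<open>odd p\<close> by (rule odd_pos)
  then have s: "0 \<le> s" "s < int p" "[s = n] (mod int p)"
    by (simp_all add: s_def)
  have "s \<noteq> 0"
    using assms(3) by (auto simp: s_def)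
  moreover have "s \<noteq> int p - 1"
  proof
    assume "s = int p - 1"
    then have "[int p - 1 + 1 = n + 1] (mod int p)"
      using s(3) by (intro cong_add cong_refl) simp
    then show False
      using cong_dvd_iff [of "int p - 1 + 1" "n + 1" "int p"] assms(4) by simp
  qed
  ultimately have range: "1 \<le> s" "s \<le> int p - 2"
    using s by linarith+
  show ?thesis
  proof (cases "s \<le> (int p - 1) div 2")
    case True
    then show ?thesis
      using range s(3) core_increment_cong [OF s(3) assms(2)] by (intro that [of s]) auto
  next
    case False
    have "[int p + (- 1 - s) = 0 + (- 1 - n)] (mod int p)"
      using s(3) by (intro cong_add cong_diff cong_refl) (simp_all add: cong_0_iff)
    then have r: "[int p - 1 - s = - 1 - n] (mod int p)"
      by (simp add: algebra_simps)
    have "int p - 1 - s \<in> {1..(int p - 1) div 2}"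
      using False range by auto
    then show ?thesis
      using r core_increment_reflect [OF assms(1,2) r] by (intro that) auto
  qed
qed

lemma core_increment_cong_iff:
  assumes "prime p" "p > 2" "k \<ge> critical_precision p"
    and n: "\<not> int p dvd n" "\<not> int p dvd n + 1"
    and m: "\<not> int p dvd m" "\<not> int p dvd m + 1"
    and eq: "[core_increment p k n = core_increment p k m] (mod int p ^ k)"
  shows "[n = m] (mod int p) \<or> [n = - 1 - m] (mod int p)"
proof -
  have "odd p"
    using assms by (simp add: prime_odd_nat)
  note sep = separating_from_critical_precision [OF assms(1,3)]
  obtain r where r: "r \<in> {1..(int p - 1) div 2}" "[r = n] (mod int p) \<or> [r = - 1 - n] (mod int p)"
    "[core_increment p k r = core_increment p k n] (mod int p ^ k)"
    using core_increment_representative [OF \<open>odd p\<close> sep(1) n] .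
  obtain t where t: "t \<in> {1..(int p - 1) div 2}" "[t = m] (mod int p) \<or> [t = - 1 - m] (mod int p)"
    "[core_increment p k t = core_increment p k m] (mod int p ^ k)"
    using core_increment_representative [OF \<open>odd p\<close> sep(1) m] .
  have "[core_increment p k r = core_increment p k t] (mod int p ^ k)"
    by (rule cong_trans [OF cong_trans [OF r(3) eq] cong_sym [OF t(3)]])
  then have "r = t"
    using r(1) t(1) unfolding cong_def by (rule inj_onD [OF sep(2)])
  have minus: "[- 1 - x = y] (mod int p) \<longleftrightarrow> [x = - 1 - y] (mod int p)" for x y
  proof -
    have "(- 1 - x) - y = - (x - (- 1 - y))" by simp
    then show ?thesis
      unfolding cong_iff_dvd_diff by (metis dvd_minus_iff)
  qed
  from r(2) t(2) \<open>r = t\<close> consider "[n = m] (mod int p)" | "[n = - 1 - m] (mod int p)"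
    | "[- 1 - n = m] (mod int p)" | "[- 1 - n = - 1 - m] (mod int p)"
    using cong_trans [OF cong_sym] by blast
  then show ?thesis
    unfolding minus by cases simp_all
qed

text \<open>
Rewrite the equation as a coincidence of differences, \<open>A a - A c \<equiv> A d - A b\<close>, where \<open>A\<close> is the
core function. If \<open>a\<close> and \<open>c\<close> differ modulo \<open>p\<close>, multiply by \<open>A l\<close> with \<open>l * (a - c) \<equiv> 1\<close>: then
\<open>l * a\<close> and \<open>l * c\<close> are consecutive modulo \<open>p\<close>, and so are \<open>l * d\<close> and \<open>l * b\<close>. Thus two core
increments, at \<open>l * c\<close> and at \<open>l * b\<close>, agree modulo \<open>p ^ k\<close>. By \<open>core_increment_cong_iff\<close> either
\<open>l * c \<equiv> l * b\<close>, which gives \<open>a \<equiv> d\<close>, or \<open>l * c \<equiv> - 1 - l * b\<close>, which gives \<open>a \<equiv> - b\<close> and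
makes the sum zero.
\<close>

lemma core_function_sum_unique:
  assumes "prime p" "p > 2" "k \<ge> critical_precision p"
    and units: "\<not> int p dvd a" "\<not> int p dvd b" "\<not> int p dvd c" "\<not> int p dvd d"
    and sum: "[core_function p k a + core_function p k b
      = core_function p k c + core_function p k d] (mod int p ^ k)"
    and nonzero: "\<not> [core_function p k a + core_function p k b = 0] (mod int p ^ k)"
  shows "[a = c] (mod int p) \<or> [a = d] (mod int p)"
proof (rule ccontr)
  assume "\<not> ?thesis"
  then have ac: "\<not> int p dvd a - c" and ad: "\<not> [a = d] (mod int p)"
    by (simp_all add: cong_iff_dvd_diff)
  have "odd p"
    using assms by (simp add: prime_odd_nat)
  have "k > 0"
    using separating_from_critical_precision(1) [OF assms(1,3)] .
  have P: "prime (int p)"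
    using assms(1) by simp
  have "coprime (a - c) (int p)"
    using prime_imp_coprime [OF P ac] by (simp add: coprime_commute)
  then obtain l where "[(a - c) * l = 1] (mod int p)"
    using cong_solve_coprime_int by blast
  then have l: "[l * a - l * c = 1] (mod int p)"
    by (simp add: algebra_simps)
  have "\<not> int p dvd l"
    using l P by (metis cong_dvd_iff dvd_diff dvd_mult2 not_prime_unit)
  then have lunits: "\<not> int p dvd l * x" if "\<not> int p dvd x" for x
    using that P by (simp add: prime_dvd_mult_iff)
  have "[core_function p k a + core_function p k b = core_function p k c + core_function p k d] (mod int p)"
    using cong_dvd_modulus [OF sum, of "int p"] \<open>k > 0\<close> by (simp add: dvd_power)
  then have "[a + b = c + d] (mod int p)"
    using core_function_cong_self [OF assms(1)] by (meson cong_add cong_sym cong_trans)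
  then have "[l * (a + b) = l * (c + d)] (mod int p)"
    by (rule cong_scalar_left)
  then have "int p dvd l * (a + b) - l * (c + d)" "int p dvd l * a - l * c - 1"
    using l by (simp_all add: cong_iff_dvd_diff)
  then have "int p dvd (l * a - l * c - 1) - (l * (a + b) - l * (c + d))"
    by (rule dvd_diff [rotated])
  then have la: "[l * c + 1 = l * a] (mod int p)" and ld: "[l * b + 1 = l * d] (mod int p)"
    using l by (simp_all add: cong_iff_dvd_diff algebra_simps dvd_diff_commute)
  have F: "core_function p k l * core_function p k x = core_function p k (l * x)" for x
    by (simp add: core_function_mult)
  have "[core_function p k l * (core_function p k a + core_function p k b)
      = core_function p k l * (core_function p k c + core_function p k d)] (mod int p ^ k)"
    using sum by (rule cong_scalar_left)
  then have "[core_function p k (l * a) - core_function p k (l * c)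
      = core_function p k (l * d) - core_function p k (l * b)] (mod int p ^ k)"
    unfolding distrib_left F by (simp add: cong_iff_dvd_diff algebra_simps)
  moreover have "[core_increment p k (l * c) = core_function p k (l * a) - core_function p k (l * c)] (mod int p ^ k)"
    "[core_increment p k (l * b) = core_function p k (l * d) - core_function p k (l * b)] (mod int p ^ k)"
    unfolding core_increment_def using la ld \<open>k > 0\<close>
    by (auto intro!: cong_diff core_function_cong)
  ultimately have "[core_increment p k (l * c) = core_increment p k (l * b)] (mod int p ^ k)"
    by (metis cong_sym cong_trans)
  then have "[l * c = l * b] (mod int p) \<or> [l * c = - 1 - l * b] (mod int p)"
    using lunits units la ld cong_dvd_iff [OF la] cong_dvd_iff [OF ld]
    by (intro core_increment_cong_iff [OF assms(1-3)]) simp_all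
  then show False
  proof
    assume "[l * c = l * b] (mod int p)"
    then have "[l * c + 1 = l * b + 1] (mod int p)"
      by (intro cong_add cong_refl)
    then have "[l * a = l * d] (mod int p)"
      using la ld by (metis cong_sym cong_trans)
    then show False
      using ad lunits [of "a - d"] by (simp add: cong_iff_dvd_diff right_diff_distrib)
  next
    assume "[l * c = - 1 - l * b] (mod int p)"
    then have "[l * c + 1 = - (l * b)] (mod int p)"
      using cong_add [OF _ cong_refl, of "l * c" "- 1 - l * b" "int p" 1] by simp
    then have "[l * a = l * (- b)] (mod int p)"
      using la by (metis cong_sym cong_trans mult_minus_right)
    then have "[a = - b] (mod int p)"
      using lunits [of "a - (- b)"] by (auto simp: cong_iff_dvd_diff algebra_simps)
    then have "[core_function p k a = core_function p k (- b)] (mod int p ^ k)"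
      using \<open>k > 0\<close> by (rule core_function_cong)
    then show False
      using nonzero \<open>odd p\<close> by (simp add: core_function_uminus cong_iff_dvd_diff)
  qed
qed

section \<open>The core as a set of residues\<close>

lemma core_iff:
  assumes "prime p" "k > 0"
  shows "x \<in> core p k \<longleftrightarrow> 0 \<le> x \<and> x < int p ^ k \<and> \<not> int p dvd x \<and> [x ^ p = x] (mod int p ^ k)"
proof -
  have P: "prime (int p)"
    using assms(1) by simp
  have "int p ^ k > 1"
    using prime_gt_1_nat [OF assms(1)] assms(2) by (intro one_less_power) simp_all
  then interpret residues "int p ^ k" "Zmod_pow p k"
    by unfold_locales simp_all
  have "coprime x (int p ^ k) \<longleftrightarrow> \<not> int p dvd x"
    using assms(2) prime_imp_coprime [OF P, of x] P
    by (auto simp: coprime_commute dest: coprime_common_divisor)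
  moreover have "x [^]\<^bsub>Zmod_pow p k\<^esub> p = x \<longleftrightarrow> [x ^ p = x] (mod int p ^ k)" if "0 \<le> x" "x < int p ^ k"
    using pow_cong [of x p] that by (simp add: cong_def)
  ultimately show ?thesis
    unfolding core_def res_units_eq by (cases "x = 0") auto
qed

lemma core_function_of_core:
  assumes "prime p" "k > 0" "x \<in> core p k"
  shows "[core_function p k x = x] (mod int p ^ k)"
  using assms core_iff unfolding core_function_def by (intro cong_power_iterate) blast

lemma core_eqI:
  assumes "prime p" "k > 0" "x \<in> core p k" "y \<in> core p k" "[x = y] (mod int p)"
  shows "x = y"
proof -
  have "[core_function p k x = core_function p k y] (mod int p ^ k)"
    using assms by (intro core_function_cong)
  then have "[x = y] (mod int p ^ k)"
    using core_function_of_core assms by (metis cong_sym cong_trans)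
  then show ?thesis
    using assms core_iff by (simp add: cong_def)
qed

lemma core_function_in_core:
  assumes "prime p" "k > 0" "\<not> int p dvd n"
  shows "core_function p k n mod int p ^ k \<in> core p k"
proof -
  let ?y = "core_function p k n mod int p ^ k"
  have "int p ^ k > 0"
    using prime_gt_0_nat [OF assms(1)] by simp
  have y: "[?y = core_function p k n] (mod int p ^ k)"
    by simp
  then have "[?y = n] (mod int p)"
    using cong_dvd_modulus [OF y, of "int p"] assms(2) core_function_cong_self [OF assms(1)]
    by (meson cong_trans dvd_power)
  then have "\<not> int p dvd ?y"
    using assms(3) by (simp add: cong_dvd_iff)
  moreover have "[?y ^ p = ?y] (mod int p ^ k)"
  proof -
    have "[?y ^ p = core_function p k n ^ p] (mod int p ^ k)"
      using y by (rule cong_pow)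
    also have "core_function p k n ^ p = core_function p k (n ^ p)"
      by (simp add: core_function_def mult.commute flip: power_mult)
    also have "[\<dots> = core_function p k n] (mod int p ^ k)"
      using assms by (intro core_function_cong fermat_little_int)
    also have "[core_function p k n = ?y] (mod int p ^ k)"
      using y by (rule cong_sym)
    finally show ?thesis .
  qed
  ultimately show ?thesis
    using \<open>int p ^ k > 0\<close> by (subst core_iff [OF assms(1,2)]) simp
qed

lemma card_core:
  assumes "prime p" "k > 0"
  shows "card (core p k) = p - 1"
proof -
  have "bij_betw (\<lambda>x. x mod int p) (core p k) {1..<int p}"
  proof (rule bij_betw_imageI)
    show "inj_on (\<lambda>x. x mod int p) (core p k)"
      using core_eqI [OF assms] by (intro inj_onI) (simp add: cong_def)
    show "(\<lambda>x. x mod int p) ` core p k = {1..<int p}"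
    proof (intro equalityI subsetI)
      fix y
      assume "y \<in> (\<lambda>x. x mod int p) ` core p k"
      then obtain x where x: "x \<in> core p k" and y: "y = x mod int p"
        by blast
      have "y \<noteq> 0"
        using x y assms by (auto simp: core_iff)
      moreover have "0 \<le> y" "y < int p"
        using prime_gt_0_nat [OF assms(1)] y by simp_all
      ultimately show "y \<in> {1..<int p}" by simp
    next
      fix y
      assume y: "y \<in> {1..<int p}"
      then have "\<not> int p dvd y"
        using zdvd_not_zless by auto
      then have "core_function p k y mod int p ^ k \<in> core p k"
        by (rule core_function_in_core [OF assms])
      moreover have "core_function p k y mod int p ^ k mod int p = y"
        using core_function_cong_self [OF assms(1), of k y] y assms(2)
        by (simp add: mod_mod_cancel dvd_power cong_def)
      ultimately show "y \<in> (\<lambda>x. x mod int p) ` core p k"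
        by force
    qed
  qed
  then show ?thesis
    by (simp add: bij_betw_same_card)
qed

lemma core_uminus:
  assumes "prime p" "p > 2" "k > 0" "x \<in> core p k"
  shows "int p ^ k - x \<in> core p k" "int p ^ k - x \<noteq> x"
proof -
  have "odd p"
    using assms by (simp add: prime_odd_nat)
  have x: "0 < x" "x < int p ^ k" "\<not> int p dvd x" "[x ^ p = x] (mod int p ^ k)"
    using assms core_iff by (force simp: le_less)+
  have "[int p ^ k - x = 0 - x] (mod int p ^ k)"
    by (intro cong_diff cong_refl) (simp add: cong_0_iff)
  then have "[(int p ^ k - x) ^ p = - (x ^ p)] (mod int p ^ k)"
    using cong_pow [of "int p ^ k - x" "- x" "int p ^ k" p] \<open>odd p\<close> by simp
  also have "[- (x ^ p) = - x] (mod int p ^ k)"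
    using x(4) by (simp add: cong_minus_minus_iff)
  also have "[- x = int p ^ k - x] (mod int p ^ k)"
    by (simp add: cong_iff_dvd_diff)
  finally have "[(int p ^ k - x) ^ p = int p ^ k - x] (mod int p ^ k)" .
  moreover have "\<not> int p dvd int p ^ k - x"
    using x(3) assms(3) dvd_power [of k "int p"] by (metis diff_diff_eq2 add_diff_cancel_left' dvd_diff)
  ultimately show "int p ^ k - x \<in> core p k"
    using x by (subst core_iff [OF assms(1,3)]) simp
  have "odd (int p ^ k)"
    using \<open>odd p\<close> by simp
  then show "int p ^ k - x \<noteq> x"
    by (metis diff_add_cancel even_add)
qed

section \<open>Counting the sums\<close>

text \<open>
Ordered pairs are counted through the order on the type. Let \<open>L\<close> be the set of pairs \<open>a < b\<close> with
nonzero sum. Then \<open>A \<times> A\<close> consists of \<open>L\<close>, its mirror image, the diagonal and the pairs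
\<open>(a, neg a)\<close>, so that \<open>(card A)\<^sup>2 = 2 * card L + 2 * card A\<close>, whereas the nonzero sums correspond
to \<open>L\<close> and the diagonal. That \<open>neg\<close> has no fixed point keeps the diagonal apart from
the pairs with sum zero.
\<close>

lemma card_distinct_sums:
  fixes A :: "'a :: linorder set" and s :: "'a \<Rightarrow> 'a \<Rightarrow> 'b"
  assumes "finite A"
    and comm: "\<And>a b. s a b = s b a"
    and neg: "\<And>a. a \<in> A \<Longrightarrow> neg a \<in> A" "\<And>a. a \<in> A \<Longrightarrow> neg a \<noteq> a"
    and zero: "\<And>a b. a \<in> A \<Longrightarrow> b \<in> A \<Longrightarrow> s a b = z \<longleftrightarrow> b = neg a"
    and unique: "\<And>a b c d. a \<in> A \<Longrightarrow> b \<in> A \<Longrightarrow> c \<in> A \<Longrightarrow> d \<in> A \<Longrightarrow>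
      s a b = s c d \<Longrightarrow> s a b \<noteq> z \<Longrightarrow> {a, b} = {c, d}"
  shows "2 * card ((\<Union>a\<in>A. \<Union>b\<in>A. {s a b}) - {z}) = (card A)\<^sup>2"
proof -
  have ne: "neg a \<noteq> a" "a \<noteq> neg a" if "a \<in> A" for a
    using neg(2) [OF that] by auto
  have Zz: "s a (neg a) = z" "s (neg a) a = z" if "a \<in> A" for a
    using zero [OF that neg(1) [OF that]] comm by simp_all
  define L where "L = {(a, b) \<in> A \<times> A. a < b \<and> s a b \<noteq> z}"
  define D where "D = (\<lambda>a. (a, a)) ` A"
  define Z where "Z = (\<lambda>a. (a, neg a)) ` A"
  have "finite L"
    using \<open>finite A\<close> by (auto simp: L_def intro: finite_subset [of _ "A \<times> A"])
  have fin: "finite L" "finite (prod.swap ` L)" "finite D" "finite Z"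
    using \<open>finite L\<close> \<open>finite A\<close> by (simp_all add: D_def Z_def)
  have cards: "card (prod.swap ` L) = card L" "card D = card A" "card Z = card A"
    unfolding D_def Z_def by (rule card_image; auto simp: inj_on_def)+
  have "A \<times> A = (L \<union> prod.swap ` L) \<union> (D \<union> Z)"
  proof (intro equalityI subsetI)
    fix u
    assume "u \<in> A \<times> A"
    then obtain a b where u: "u = (a, b)" "a \<in> A" "b \<in> A"
      by blast
    consider "s a b = z" | "a = b" | "s a b \<noteq> z" "a < b" | "s b a \<noteq> z" "b < a"
      using linorder_less_linear [of a b] comm [of a b] by auto
    then show "u \<in> (L \<union> prod.swap ` L) \<union> (D \<union> Z)"
    proof cases
      case 1
      then show ?thesis
        using u zero by (simp add: Z_def)
    next
      case 2
      then show ?thesis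
        using u by (simp add: D_def)
    next
      case 3
      then show ?thesis
        using u by (simp add: L_def)
    next
      case 4
      then have "(b, a) \<in> L"
        using u by (simp add: L_def)
      then show ?thesis
        unfolding u by (force intro: image_eqI [of _ prod.swap])
    qed
  qed (use neg in \<open>auto simp: L_def D_def Z_def\<close>)
  moreover have "L \<inter> prod.swap ` L = {}" "D \<inter> Z = {}" "(L \<union> prod.swap ` L) \<inter> (D \<union> Z) = {}"
    using ne Zz by (auto simp: L_def D_def Z_def)
  ultimately have "card (A \<times> A) = 2 * card L + 2 * card A"
    using fin cards by (simp add: card_Un_disjoint)
  moreover have "(\<Union>a\<in>A. \<Union>b\<in>A. {s a b}) - {z} = case_prod s ` (L \<union> D)"
  proof (intro equalityI subsetI)
    fix t
    assume "t \<in> (\<Union>a\<in>A. \<Union>b\<in>A. {s a b}) - {z}"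
    then obtain a b where t: "t = s a b" "a \<in> A" "b \<in> A" "s a b \<noteq> z"
      by blast
    consider "a = b" | "a < b" | "b < a"
      by (rule linorder_cases) auto
    then show "t \<in> case_prod s ` (L \<union> D)"
    proof cases
      case 3
      then have "(b, a) \<in> L" "t = case_prod s (b, a)"
        using t comm by (auto simp: L_def)
      then show ?thesis by blast
    qed (use t in \<open>force simp: L_def D_def\<close>)+
  next
    fix t
    assume "t \<in> case_prod s ` (L \<union> D)"
    then show "t \<in> (\<Union>a\<in>A. \<Union>b\<in>A. {s a b}) - {z}"
      using neg zero by (force simp: L_def D_def)
  qed
  moreover have "inj_on (case_prod s) (L \<union> D)"
  proof (rule inj_onI)
    fix u v
    assume uv: "u \<in> L \<union> D" "v \<in> L \<union> D" "case_prod s u = case_prod s v"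
    obtain a b c d where ab: "u = (a, b)" and cd: "v = (c, d)"
      by (metis surj_pair)
    have "a \<in> A" "b \<in> A" "c \<in> A" "d \<in> A" and le: "a \<le> b" "c \<le> d" and "s a b \<noteq> z"
      using uv ne zero unfolding ab cd by (auto simp: L_def D_def)
    then have "{a, b} = {c, d}"
      using uv(3) unfolding ab cd by (intro unique) simp_all
    then show "u = v"
      unfolding ab cd using le by (auto simp: doubleton_eq_iff)
  qed
  moreover have "card (L \<union> D) = card L + card A"
    using fin cards by (subst card_Un_disjoint) (auto simp: L_def D_def)
  ultimately show ?thesis
    by (simp add: card_image power2_eq_square flip: card_cartesian_product)
qed

theorem theorem2p1:
  fixes p k :: nat
  assumes "prime p" and "p > 2" and "k \<ge> critical_precision p"
  shows "(\<forall>a \<in> core p k. \<forall>b \<in> core p k. \<forall>c \<in> core p k. \<forall>d \<in> core p k.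
            a \<oplus>\<^bsub>Zmod_pow p k\<^esub> b = c \<oplus>\<^bsub>Zmod_pow p k\<^esub> d \<and>
            a \<oplus>\<^bsub>Zmod_pow p k\<^esub> b \<noteq> \<zero>\<^bsub>Zmod_pow p k\<^esub>
            \<longrightarrow> {a, b} = {c, d}) \<and>
         real (card ((core p k <+>\<^bsub>Zmod_pow p k\<^esub> core p k) - {\<zero>\<^bsub>Zmod_pow p k\<^esub>}))
           = (1 / 2) * (real (card (core p k)))\<^sup>2 \<and>
         (1 / 2) * (real (card (core p k)))\<^sup>2 = (real p - 1)\<^sup>2 / 2"
proof -
  let ?A = "core p k" and ?M = "int p ^ k"
  have "k > 0"
    using separating_from_critical_precision(1) [OF assms(1,3)] .
  have add: "a \<oplus>\<^bsub>Zmod_pow p k\<^esub> b = (a + b) mod ?M" for a b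
    by (simp add: residue_ring_def)
  have zero: "\<zero>\<^bsub>Zmod_pow p k\<^esub> = 0"
    by (simp add: residue_ring_def)
  note core = core_iff [OF assms(1) \<open>k > 0\<close>]
  have unique: "{a, b} = {c, d}"
    if "a \<in> ?A" "b \<in> ?A" "c \<in> ?A" "d \<in> ?A"
      and eq: "(a + b) mod ?M = (c + d) mod ?M" and nz: "(a + b) mod ?M \<noteq> 0" for a b c d
  proof -
    note F = core_function_of_core [OF assms(1) \<open>k > 0\<close>]
    have "[core_function p k a + core_function p k b = a + b] (mod ?M)"
      "[core_function p k c + core_function p k d = c + d] (mod ?M)"
      using that by (auto intro!: cong_add F)
    then have "[a = c] (mod int p) \<or> [a = d] (mod int p)"
      using that by (intro core_function_sum_unique [OF assms, of a b c d]) (auto simp: core cong_def)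
    then have "a = c \<or> a = d"
      using core_eqI [OF assms(1) \<open>k > 0\<close>] that by blast
    then show ?thesis
    proof
      assume "a = c"
      then have "[b = d] (mod ?M)"
        using eq cong_add_lcancel [of a b d ?M] by (simp add: cong_def)
      then have "b = d"
        using that core by (simp add: cong_def)
      then show ?thesis
        using \<open>a = c\<close> by simp
    next
      assume "a = d"
      then have "[b = c] (mod ?M)"
        using eq cong_add_lcancel [of a b c ?M] by (simp add: cong_def add.commute)
      then have "b = c"
        using that core by (simp add: cong_def)
      then show ?thesis
        using \<open>a = d\<close> by auto
    qed
  qed
  have neg_unique: "(a + b) mod ?M = 0 \<longleftrightarrow> b = ?M - a" if "a \<in> ?A" "b \<in> ?A" for a b
  proof
    assume "(a + b) mod ?M = 0"
    then have "?M dvd a + b"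
      by (simp add: dvd_eq_mod_eq_0)
    then obtain q where q: "a + b = ?M * q" ..
    have "0 < a" "a < ?M" "0 < b" "b < ?M"
      using that by (force simp: core le_less)+
    then have "0 < ?M * q" "?M * q < ?M * 2"
      using q by linarith+
    then have "q = 1"
      using \<open>a < ?M\<close> \<open>0 < a\<close> by (simp add: zero_less_mult_iff)
    then show "b = ?M - a"
      using q by simp
  qed simp
  have "card ?A = p - 1"
    using card_core [OF assms(1) \<open>k > 0\<close>] .
  then have card: "real (card ?A) = real p - 1"
    using assms(2) by simp
  have "finite ?A"
    using \<open>card ?A = p - 1\<close> assms(2) by (intro card_ge_0_finite) simp
  have "2 * card ((\<Union>a\<in>?A. \<Union>b\<in>?A. {(a + b) mod ?M}) - {0}) = (card ?A)\<^sup>2"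
  proof (rule card_distinct_sums [where neg = "\<lambda>a. ?M - a" and s = "\<lambda>a b. (a + b) mod ?M"])
    show "(a + b) mod ?M = (b + a) mod ?M" for a b
      by (simp add: add.commute)
  qed (fact \<open>finite ?A\<close> | fact core_uminus [OF assms(1,2) \<open>k > 0\<close>] | fact neg_unique | fact unique)+
  then have "2 * card ((?A <+>\<^bsub>Zmod_pow p k\<^esub> ?A) - {0}) = (card ?A)\<^sup>2"
    by (simp add: set_add_def' add)
  from arg_cong [OF this, of real]
  have count: "2 * real (card ((?A <+>\<^bsub>Zmod_pow p k\<^esub> ?A) - {0})) = (real p - 1)\<^sup>2"
    by (simp only: of_nat_mult of_nat_numeral of_nat_power card)
  show ?thesis
    unfolding zero add card
  proof (intro conjI ballI impI)
    show "{a, b} = {c, d}" if "a \<in> ?A" "b \<in> ?A" "c \<in> ?A" "d \<in> ?A"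
      and "(a + b) mod ?M = (c + d) mod ?M \<and> (a + b) mod ?M \<noteq> 0" for a b c d
      using unique that by blast
    show "real (card ((?A <+>\<^bsub>Zmod_pow p k\<^esub> ?A) - {0})) = 1 / 2 * (real p - 1)\<^sup>2"
      using count by linarith
  qed simp
qed

end
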